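(* Let $T>0$, $\gamma\in\left(\frac13,\frac12\right]$, $\kappa\in(0,1)$ with $\kappa+\gamma>1$, let $a\in\mathbb{R}$, and let $x:[0,T]\to\mathbb{R}$ be a $\gamma$-Hölder continuous path with $x_0=0$. Let $\sigma:\mathbb{R}\to\mathbb{R}$ be the power function $\sigma(\xi)=|\xi|^{\kappa}$ and let $\phi(\xi)=\int_0^{\xi}\frac{ds}{\sigma(s)}$ for $\xi\in\mathbb{R}$. Then the function $y=\phi^{-1}(x+\phi(a))$ is a solution of the equation $$y_t=a+\int_0^t\sigma(y_s)\,dx_s,\qquad t\in[0,T],$$ where the integral is a rough integral with respect to $x$.
   Context: For a path $f$ write $\delta f_{st}=f_t-f_s$. In dimension one, $x$ is lifted to a rough path by $\mathbf{x}^2_{st}=\frac12(\delta x_{st})^2$, which is the only choice satisfying $\mathbf{x}^2_{st}+\mathbf{x}^2_{st}=(\delta x_{st})^2$. Controlled processes: for $\eta>\gamma$, a $\gamma$-Hölder path $m:[0,T]\to\mathbb{R}$ is weakly controlled by $x$ with a remainder of order $\eta$ if $\delta m_{st}=\mu_s\,\delta x_{st}+r_{st}$ for all $0\le s\le t\le T$, where $\mu$ is a bounded $(\eta-\gamma)$-Hölder path and $\sup_{s<t}|r_{st}|/|t-s|^{\eta}<\infty$. Rough integral: if moreover $\eta+\gamma>1$, the integral of $m$ (with derivative $\mu$) against $x$ is $$\int_s^t m_u\,dx_u=\lim_{|\Pi_{st}|\to0}\sum_{q=0}^{n-1}\left[m_{t_q}\delta x_{t_qt_{q+1}}+\mu_{t_q}\mathbf{x}^2_{t_qt_{q+1}}\right],$$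 the limit being over partitions $\Pi_{st}=\{s=t_0<\dots<t_n=t\}$ of $[s,t]$ with mesh going to zero. In the equation, $m=\sigma(y)$ is taken with derivative $\mu=(\sigma'\sigma)(y)$, where $\sigma'\sigma$ is extended by the value $0$ at $\xi=0$. *)

theory Defs
  imports "HOL-Analysis.Analysis"
begin

definition hoelder_on :: "real \<Rightarrow> real set \<Rightarrow> (real \<Rightarrow> real) \<Rightarrow> bool" where
  "hoelder_on \<gamma> S f \<longleftrightarrow> (\<exists>C. \<forall>s\<in>S. \<forall>t\<in>S. \<bar>f t - f s\<bar> \<le> C * \<bar>t - s\<bar> powr \<gamma>)"

definition increment :: "(real \<Rightarrow> real) \<Rightarrow> real \<Rightarrow> real \<Rightarrow> real" where
  "increment f s t = f t - f s"

definition second_level :: "(real \<Rightarrow> real) \<Rightarrow> real \<Rightarrow> real \<Rightarrow> real" where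
  "second_level x s t = (1 / 2) * (increment x s t)\<^sup>2"

definition weakly_controlled ::
    "real \<Rightarrow> real \<Rightarrow> real \<Rightarrow> (real \<Rightarrow> real) \<Rightarrow> (real \<Rightarrow> real) \<Rightarrow> (real \<Rightarrow> real) \<Rightarrow> bool" where
  "weakly_controlled T \<gamma> \<eta> x m \<mu> \<longleftrightarrow>
     \<eta> > \<gamma> \<and> hoelder_on \<gamma> {0..T} m \<and>
     bounded (\<mu> ` {0..T}) \<and> hoelder_on (\<eta> - \<gamma>) {0..T} \<mu> \<and>
     (\<exists>r. (\<forall>s t. 0 \<le> s \<and> s \<le> t \<and> t \<le> T \<longrightarrow> increment m s t = \<mu> s * increment x s t + r s t) \<and>
          (\<exists>C. \<forall>s t. 0 \<le> s \<and> s < t \<and> t \<le> T \<longrightarrow> \<bar>r s t\<bar> / \<bar>t - s\<bar> powr \<eta> \<le> C))"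

definition is_partition :: "real \<Rightarrow> real \<Rightarrow> nat \<Rightarrow> (nat \<Rightarrow> real) \<Rightarrow> bool" where
  "is_partition s t n p \<longleftrightarrow> p 0 = s \<and> p n = t \<and> (\<forall>q<n. p q < p (Suc q))"

definition rough_sum ::
    "(real \<Rightarrow> real) \<Rightarrow> (real \<Rightarrow> real) \<Rightarrow> (real \<Rightarrow> real) \<Rightarrow> nat \<Rightarrow> (nat \<Rightarrow> real) \<Rightarrow> real" where
  "rough_sum x m \<mu> n p =
     (\<Sum>q<n. m (p q) * increment x (p q) (p (Suc q))
            + \<mu> (p q) * second_level x (p q) (p (Suc q)))"

text \<open>
  The rough integral of \<open>m\<close> (with derivative \<open>\<mu>\<close>) against \<open>x\<close> over \<open>[s, t]\<close> exists and
  equals \<open>I\<close>. The limit is over all partitions as the mesh tends to zero; for \<open>s = t\<close> the only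
  partition has \<open>n = 0\<close> and the integral is \<open>0\<close>.
\<close>
definition has_rough_integral ::
    "(real \<Rightarrow> real) \<Rightarrow> (real \<Rightarrow> real) \<Rightarrow> (real \<Rightarrow> real) \<Rightarrow> real \<Rightarrow> real \<Rightarrow> real \<Rightarrow> bool" where
  "has_rough_integral x m \<mu> s t I \<longleftrightarrow>
     (\<forall>\<epsilon>>0. \<exists>\<delta>>0. \<forall>n p. is_partition s t n p \<and> (\<forall>q<n. p (Suc q) - p q < \<delta>)
        \<longrightarrow> \<bar>rough_sum x m \<mu> n p - I\<bar> < \<epsilon>)"

text \<open>The function \<open>\<sigma>'\<sigma>\<close>, extended by \<open>0\<close> at the origin, where \<open>\<sigma>\<close> need not be
  differentiable.\<close>
definition deriv_times_self :: "(real \<Rightarrow> real) \<Rightarrow> real \<Rightarrow> real" where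
  "deriv_times_self \<sigma> \<xi> = (if \<xi> = 0 then 0 else deriv \<sigma> \<xi> * \<sigma> \<xi>)"

text \<open>
  \<open>y\<close> solves \<open>y\<^sub>t = a + \<integral>\<^sub>0\<^sup>t \<sigma>(y\<^sub>s) dx\<^sub>s\<close> on \<open>[0, T]\<close>. The first conjunct says that the integrand
  is an admissible one: \<open>\<sigma>(y)\<close> with derivative \<open>(\<sigma>'\<sigma>)(y)\<close> is weakly controlled by \<open>x\<close> with a
  remainder of some order \<open>\<eta>\<close> such that \<open>\<eta> + \<gamma> > 1\<close>.
\<close>
definition solves_rough_equation ::
    "real \<Rightarrow> real \<Rightarrow> (real \<Rightarrow> real) \<Rightarrow> (real \<Rightarrow> real) \<Rightarrow> real \<Rightarrow> (real \<Rightarrow> real) \<Rightarrow> bool" where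
  "solves_rough_equation T \<gamma> x \<sigma> a y \<longleftrightarrow>
     (\<exists>\<eta>. \<eta> + \<gamma> > 1 \<and>
        weakly_controlled T \<gamma> \<eta> x (\<lambda>t. \<sigma> (y t)) (\<lambda>t. deriv_times_self \<sigma> (y t))) \<and>
     (\<forall>t\<in>{0..T}. \<exists>I. has_rough_integral x (\<lambda>u. \<sigma> (y u)) (\<lambda>u. deriv_times_self \<sigma> (y u)) 0 t I
        \<and> y t = a + I)"

end

theory Submission
  imports Defs
begin

text \<open>
  With \<open>p = 1 / (1 - \<kappa>)\<close>, the inverse of \<open>\<phi>\<close> is \<open>G z = sgn z * \<bar>(1 - \<kappa>) z\<bar> powr p\<close>, and \<open>\<sigma> \<circ> G\<close> and
  \<open>(\<sigma>'\<sigma>) \<circ> G\<close> are \<open>G'\<close> and \<open>G''\<close>. The condition \<open>\<kappa> + \<gamma> > 1\<close> means \<open>p > 1 / \<gamma> \<ge> 2\<close>, so \<open>G''\<close> is locally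
  \<open>\<alpha>\<close>-Hoelder with \<open>\<alpha> = min 1 (p - 2)\<close> and \<open>(2 + \<alpha>) \<gamma> > 1\<close>. Hence the second-order Taylor remainders of
  \<open>G\<close> along \<open>x + \<phi> a\<close> are of order \<open>(2 + \<alpha>) \<gamma>\<close> and vanish in the limit of the compensated sums.
\<close>

section \<open>Taylor remainders with Hoelder derivatives\<close>

text \<open>The constant in \<open>hoelder_on\<close> may be negative, for instance on a one-point
  set; \<open>max C 0\<close> has the sign that later monotonicity steps use.\<close>

lemma hoelder_onE:
  assumes "hoelder_on \<alpha> S f"
  obtains C where "C \<ge> 0" "\<And>s t. s \<in> S \<Longrightarrow> t \<in> S \<Longrightarrow> \<bar>f t - f s\<bar> \<le> C * \<bar>t - s\<bar> powr \<alpha>"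
proof -
  obtain C where C: "\<And>s t. s \<in> S \<Longrightarrow> t \<in> S \<Longrightarrow> \<bar>f t - f s\<bar> \<le> C * \<bar>t - s\<bar> powr \<alpha>"
    using assms unfolding hoelder_on_def by blast
  show thesis
  proof (rule that[of "max C 0"])
    fix s t assume "s \<in> S" "t \<in> S"
    then have "\<bar>f t - f s\<bar> \<le> C * \<bar>t - s\<bar> powr \<alpha>" by (rule C)
    also have "\<dots> \<le> max C 0 * \<bar>t - s\<bar> powr \<alpha>" by (intro mult_right_mono) auto
    finally show "\<bar>f t - f s\<bar> \<le> max C 0 * \<bar>t - s\<bar> powr \<alpha>" .
  qed simp
qed

lemma hoelder_on_cmult:
  assumes "hoelder_on \<alpha> S f"
  shows "hoelder_on \<alpha> S (\<lambda>t. c * f t)"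
proof -
  obtain C where C: "\<And>s t. s \<in> S \<Longrightarrow> t \<in> S \<Longrightarrow> \<bar>f t - f s\<bar> \<le> C * \<bar>t - s\<bar> powr \<alpha>"
    using assms unfolding hoelder_on_def by blast
  have "\<bar>c\<bar> * \<bar>f t - f s\<bar> \<le> \<bar>c\<bar> * (C * \<bar>t - s\<bar> powr \<alpha>)" if "s \<in> S" "t \<in> S" for s t
    using C[OF that] by (intro mult_left_mono) auto
  then have "\<bar>c * f t - c * f s\<bar> \<le> (\<bar>c\<bar> * C) * \<bar>t - s\<bar> powr \<alpha>" if "s \<in> S" "t \<in> S" for s t
    using that by (simp only: right_diff_distrib[symmetric] abs_mult mult.assoc)
  then show ?thesis unfolding hoelder_on_def by blast
qed

text \<open>\<open>closed_segment\<close> leaves the order of \<open>z\<close> and \<open>w\<close>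
  open, since the values of \<open>x\<close> at successive times may come in either order.\<close>

lemma mean_value_segment_bound:
  fixes f :: "real \<Rightarrow> real"
  assumes "\<And>u. u \<in> closed_segment z w \<Longrightarrow> (f has_real_derivative f' u) (at u)"
    and "\<And>u. u \<in> closed_segment z w \<Longrightarrow> \<bar>f' u\<bar> \<le> B"
  shows "\<bar>f w - f z\<bar> \<le> B * \<bar>w - z\<bar>"
  using field_differentiable_bound[of "closed_segment z w" f f' B w z] assms
  by (auto intro: has_field_derivative_at_within)

lemma powr_one_plus_abs: "\<bar>d\<bar> powr b * \<bar>d\<bar> = \<bar>d\<bar> powr (1 + b)" for d :: real
  by (cases "d = 0") (auto simp: powr_add)

text \<open>Apply the mean value bound to \<open>g\<close> minus its linear part at
  \<open>z\<close>, whose derivative is \<open>h u - h z\<close>. The bound on \<open>h\<close> is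
  based at \<open>z\<close> alone, so that the lemma can be reused one order higher.\<close>

lemma taylor_remainder_hoelder:
  fixes g h :: "real \<Rightarrow> real"
  assumes g: "\<And>u. u \<in> closed_segment z w \<Longrightarrow> (g has_real_derivative h u) (at u)"
    and h: "\<And>u. u \<in> closed_segment z w \<Longrightarrow> \<bar>h u - h z\<bar> \<le> C * \<bar>u - z\<bar> powr \<alpha>"
    and "C \<ge> 0" "\<alpha> \<ge> 0"
  shows "\<bar>g w - g z - h z * (w - z)\<bar> \<le> C * \<bar>w - z\<bar> powr (1 + \<alpha>)"
proof -
  let ?f = "\<lambda>u. g u - h z * (u - z)"
  have "\<bar>?f w - ?f z\<bar> \<le> (C * \<bar>w - z\<bar> powr \<alpha>) * \<bar>w - z\<bar>"
  proof (rule mean_value_segment_bound[where f' = "\<lambda>u. h u - h z"])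
    fix u assume u: "u \<in> closed_segment z w"
    show "(?f has_real_derivative h u - h z) (at u)"
      by (auto intro!: derivative_eq_intros g[OF u])
    have "\<bar>u - z\<bar> \<le> \<bar>w - z\<bar>"
      using segment_bound1[OF u] by simp
    then have "C * \<bar>u - z\<bar> powr \<alpha> \<le> C * \<bar>w - z\<bar> powr \<alpha>"
      using assms by (intro mult_left_mono powr_mono2) auto
    with h[OF u] show "\<bar>h u - h z\<bar> \<le> C * \<bar>w - z\<bar> powr \<alpha>" by linarith
  qed
  then show ?thesis by (simp add: mult.assoc powr_one_plus_abs)
qed

text \<open>Removing the quadratic term leaves a function with derivative
  \<open>g u - h z * (u - z)\<close>. By the first-order lemma this derivative is Hoelder of order
  \<open>1 + \<alpha>\<close> at \<open>z\<close>, so the same lemma applies again.\<close>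

lemma taylor_remainder2_hoelder:
  fixes G g h :: "real \<Rightarrow> real"
  assumes G: "\<And>u. u \<in> closed_segment z w \<Longrightarrow> (G has_real_derivative g u) (at u)"
    and g: "\<And>u. u \<in> closed_segment z w \<Longrightarrow> (g has_real_derivative h u) (at u)"
    and h: "\<And>u. u \<in> closed_segment z w \<Longrightarrow> \<bar>h u - h z\<bar> \<le> C * \<bar>u - z\<bar> powr \<alpha>"
    and "C \<ge> 0" "\<alpha> \<ge> 0"
  shows "\<bar>G w - G z - g z * (w - z) - h z * ((1 / 2) * (w - z)\<^sup>2)\<bar> \<le> C * \<bar>w - z\<bar> powr (2 + \<alpha>)"
proof -
  let ?f = "\<lambda>u. G u - h z * ((1 / 2) * (u - z)\<^sup>2)"
  have sub: "closed_segment z u \<subseteq> closed_segment z w" if "u \<in> closed_segment z w" for u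
    using that by (simp add: subset_closed_segment)
  have "\<bar>?f w - ?f z - (g z - h z * (z - z)) * (w - z)\<bar> \<le> C * \<bar>w - z\<bar> powr (1 + (1 + \<alpha>))"
  proof (rule taylor_remainder_hoelder[where h = "\<lambda>u. g u - h z * (u - z)"])
    fix u assume u: "u \<in> closed_segment z w"
    show "(?f has_real_derivative g u - h z * (u - z)) (at u)"
      by (auto intro!: derivative_eq_intros G[OF u] simp: field_simps)
    have "\<bar>g u - g z - h z * (u - z)\<bar> \<le> C * \<bar>u - z\<bar> powr (1 + \<alpha>)"
      by (rule taylor_remainder_hoelder) (use sub[OF u] assms in auto)
    then show "\<bar>g u - h z * (u - z) - (g z - h z * (z - z))\<bar> \<le> C * \<bar>u - z\<bar> powr (1 + \<alpha>)"
      by (simp add: algebra_simps)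
  qed (use assms in auto)
  then show ?thesis by (simp add: algebra_simps)
qed

section \<open>Change of variables for rough integrals\<close>

text \<open>Hoelder exponents multiply under composition. The shift \<open>b\<close> makes room for
  the constant \<open>\<phi> a\<close> added to \<open>x\<close>.\<close>

lemma hoelder_on_compose:
  assumes f: "hoelder_on \<alpha> S f" and x: "hoelder_on \<gamma> A x"
    and "\<alpha> \<ge> 0" "\<And>t. t \<in> A \<Longrightarrow> x t + b \<in> S"
  shows "hoelder_on (\<alpha> * \<gamma>) A (\<lambda>t. f (x t + b))"
proof -
  obtain C where C: "C \<ge> 0" "\<And>s t. s \<in> S \<Longrightarrow> t \<in> S \<Longrightarrow> \<bar>f t - f s\<bar> \<le> C * \<bar>t - s\<bar> powr \<alpha>"
    using hoelder_onE[OF f] by blast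
  obtain K where K: "K \<ge> 0" "\<And>s t. s \<in> A \<Longrightarrow> t \<in> A \<Longrightarrow> \<bar>x t - x s\<bar> \<le> K * \<bar>t - s\<bar> powr \<gamma>"
    using hoelder_onE[OF x] by blast
  show ?thesis
    unfolding hoelder_on_def
  proof (intro exI ballI)
    fix s t assume st: "s \<in> A" "t \<in> A"
    have "\<bar>f (x t + b) - f (x s + b)\<bar> \<le> C * \<bar>x t - x s\<bar> powr \<alpha>"
      using C(2)[of "x s + b" "x t + b"] assms(4) st by simp
    also have "\<dots> \<le> C * (K * \<bar>t - s\<bar> powr \<gamma>) powr \<alpha>"
      using C(1) K(2)[OF st] \<open>\<alpha> \<ge> 0\<close> by (intro mult_left_mono powr_mono2) auto
    also have "\<dots> = (C * K powr \<alpha>) * \<bar>t - s\<bar> powr (\<alpha> * \<gamma>)"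
      using K(1) by (simp add: powr_mult powr_powr mult.commute mult.left_commute)
    finally show "\<bar>f (x t + b) - f (x s + b)\<bar> \<le> (C * K powr \<alpha>) * \<bar>t - s\<bar> powr (\<alpha> * \<gamma>)" .
  qed
qed

lemma hoelder_on_bounded:
  assumes "hoelder_on \<gamma> {0..T} f" "\<gamma> \<ge> 0"
  shows "bounded (f ` {0..T})"
proof (cases "T \<ge> 0")
  case True
  obtain K where K: "K \<ge> 0" "\<And>s t. s \<in> {0..T} \<Longrightarrow> t \<in> {0..T} \<Longrightarrow> \<bar>f t - f s\<bar> \<le> K * \<bar>t - s\<bar> powr \<gamma>"
    using hoelder_onE[OF assms(1)] by blast
  have "\<bar>f t\<bar> \<le> \<bar>f 0\<bar> + K * T powr \<gamma>" if t: "t \<in> {0..T}" for t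
  proof -
    have "\<bar>f t - f 0\<bar> \<le> K * \<bar>t - 0\<bar> powr \<gamma>"
      using True t by (intro K(2)) auto
    also have "\<dots> \<le> K * T powr \<gamma>"
      using t K(1) assms(2) by (intro mult_left_mono powr_mono2) auto
    finally show ?thesis by linarith
  qed
  then show ?thesis by (intro boundedI[of _ "\<bar>f 0\<bar> + K * T powr \<gamma>"]) auto
qed simp

lemma is_partition_bounds:
  assumes "is_partition s t n p" "q \<le> n"
  shows "p q \<in> {s..t}"
proof -
  have step: "p q < p (Suc q)" if "q < n" for q
    using assms(1) that by (simp add: is_partition_def)
  have "p i \<le> p j" if "i \<le> j" "j \<le> n" for i j
    using that
  proof (induction j rule: dec_induct)
    case (step j)
    then show ?case using \<open>\<And>q. q < n \<Longrightarrow> p q < p (Suc q)\<close>[of j] by simp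
  qed simp
  from this[of 0 q] this[of q n] show ?thesis
    using assms by (auto simp: is_partition_def)
qed

text \<open>Increments of \<open>Y\<close> telescope over a partition, so the error of the
  compensated sum is a sum of local remainders, at most \<open>C * (t - s)\<close> times the mesh to
  the power \<open>\<theta> - 1\<close>. As the primitive \<open>Y\<close> is given, no sewing
  argument is involved.\<close>

lemma has_rough_integral_of_remainder:
  assumes R: "\<And>u v. s \<le> u \<Longrightarrow> u < v \<Longrightarrow> v \<le> t \<Longrightarrow>
      \<bar>Y v - Y u - m u * increment x u v - \<mu> u * second_level x u v\<bar> \<le> C * (v - u) powr \<theta>"
    and "\<theta> > 1" "C \<ge> 0" "s \<le> t"
  shows "has_rough_integral x m \<mu> s t (Y t - Y s)"
  unfolding has_rough_integral_def
proof (intro allI impI)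
  fix \<epsilon> :: real assume "\<epsilon> > 0"
  \<comment> \<open>Adding \<open>1\<close> keeps \<open>D\<close> positive and gives
    \<open>C * (t - s) = D - 1 < D\<close>, which makes the final inequality strict.\<close>
  define D where "D = C * (t - s) + 1"
  have "D > 0" using assms by (simp add: D_def add_nonneg_pos)
  define \<delta> where "\<delta> = (\<epsilon> / D) powr (1 / (\<theta> - 1))"
  have \<delta>: "\<delta> > 0" "\<delta> powr (\<theta> - 1) = \<epsilon> / D"
    using \<open>\<epsilon> > 0\<close> \<open>D > 0\<close> \<open>\<theta> > 1\<close> by (auto simp: \<delta>_def powr_powr)
  show "\<exists>\<delta>>0. \<forall>n p. is_partition s t n p \<and> (\<forall>q<n. p (Suc q) - p q < \<delta>)
        \<longrightarrow> \<bar>rough_sum x m \<mu> n p - (Y t - Y s)\<bar> < \<epsilon>"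
  proof (intro exI conjI allI impI)
    fix n p assume "is_partition s t n p \<and> (\<forall>q<n. p (Suc q) - p q < \<delta>)"
    then have P: "is_partition s t n p" and mesh: "\<And>q. q < n \<Longrightarrow> p (Suc q) - p q < \<delta>"
      by auto
    have inc: "p q < p (Suc q)" if "q < n" for q
      using P that by (simp add: is_partition_def)
    have ends: "p 0 = s" "p n = t" using P by (auto simp: is_partition_def)
    let ?r = "\<lambda>q. Y (p (Suc q)) - Y (p q) - m (p q) * increment x (p q) (p (Suc q))
                - \<mu> (p q) * second_level x (p q) (p (Suc q))"
    have r: "\<bar>?r q\<bar> \<le> C * (\<epsilon> / D) * (p (Suc q) - p q)" if q: "q < n" for q
    proof -
      let ?d = "p (Suc q) - p q"
      have "\<bar>?r q\<bar> \<le> C * ?d powr \<theta>"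
        using is_partition_bounds[OF P, of q] is_partition_bounds[OF P, of "Suc q"] q inc[OF q]
        by (intro R) auto
      \<comment> \<open>One factor of the step length is kept for telescoping; the remaining power
        \<open>\<theta> - 1\<close> is bounded through the mesh.\<close>
      also have "?d powr \<theta> = ?d powr (\<theta> - 1) * ?d"
        using inc[OF q] powr_add[of ?d "\<theta> - 1" 1] by simp
      also have "C * \<dots> \<le> C * (\<delta> powr (\<theta> - 1) * ?d)"
        using assms inc[OF q] mesh[OF q]
        by (intro mult_left_mono mult_right_mono powr_mono2) auto
      finally show ?thesis by (simp add: \<delta>)
    qed
    have "(\<Sum>q<n. Y (p (Suc q)) - Y (p q)) = Y t - Y s"
      using sum_lessThan_telescope[of "\<lambda>q. Y (p q)" n] ends by simp
    then have "rough_sum x m \<mu> n p - (Y t - Y s) = - (\<Sum>q<n. ?r q)"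
      unfolding rough_sum_def by (simp add: sum_subtractf sum.distrib)
    then have "\<bar>rough_sum x m \<mu> n p - (Y t - Y s)\<bar> \<le> (\<Sum>q<n. \<bar>?r q\<bar>)"
      by (simp only: abs_minus_cancel sum_abs)
    also have "\<dots> \<le> (\<Sum>q<n. C * (\<epsilon> / D) * (p (Suc q) - p q))"
      using r by (intro sum_mono) auto
    also have "\<dots> = C * (\<epsilon> / D) * (t - s)"
      using sum_lessThan_telescope[of p n] ends by (metis sum_distrib_left)
    also have "\<dots> = \<epsilon> * ((D - 1) / D)"
      by (simp add: D_def)
    also have "\<dots> < \<epsilon> * 1"
      using \<open>\<epsilon> > 0\<close> \<open>D > 0\<close> by (intro mult_strict_left_mono) auto
    finally show "\<bar>rough_sum x m \<mu> n p - (Y t - Y s)\<bar> < \<epsilon>" by simp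
  qed (rule \<delta>)
qed

lemma hoelder_on_of_bounded_derivative:
  assumes g: "\<And>u. (g has_real_derivative h u) (at u)" and "bounded (h ` {-M..M})"
  shows "hoelder_on 1 {-M..M} g"
proof -
  obtain B where "\<And>u. u \<in> {-M..M} \<Longrightarrow> \<bar>h u\<bar> \<le> B"
    using assms(2) unfolding bounded_iff by force
  then have "\<bar>g t - g s\<bar> \<le> B * \<bar>t - s\<bar> powr 1" if "s \<in> {-M..M}" "t \<in> {-M..M}" for s t
    using mean_value_segment_bound[of s t g h B] g that
      closed_segment_subset[OF that convex_real_interval(5)] by (auto simp: subset_iff)
  then show ?thesis unfolding hoelder_on_def by blast
qed

text \<open>Since \<open>second_level x\<close> is half the squared increment, each compensated
  summand is the second-order Taylor term of \<open>G\<close> along \<open>x + b\<close>, and no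
  correction term appears. The Hoelder bound on \<open>h\<close> is local, which fits a bounded
  path.\<close>

lemma rough_chain_rule:
  fixes G g h x :: "real \<Rightarrow> real"
  assumes G: "\<And>u. (G has_real_derivative g u) (at u)"
    and g: "\<And>u. (g has_real_derivative h u) (at u)"
    and h: "\<And>M. hoelder_on \<alpha> {-M..M} h"
    and x: "hoelder_on \<gamma> {0..T} x"
    and "\<alpha> > 0" "\<gamma> > 0" "(2 + \<alpha>) * \<gamma> > 1"
  shows "weakly_controlled T \<gamma> ((1 + \<alpha>) * \<gamma>) x (\<lambda>t. g (x t + b)) (\<lambda>t. h (x t + b))"
    and "t \<in> {0..T} \<Longrightarrow> has_rough_integral x (\<lambda>t. g (x t + b)) (\<lambda>t. h (x t + b)) 0 t
           (G (x t + b) - G (x 0 + b))"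
proof -
  obtain B where B: "\<And>t. t \<in> {0..T} \<Longrightarrow> \<bar>x t\<bar> \<le> B"
    using hoelder_on_bounded[OF x] \<open>\<gamma> > 0\<close> unfolding bounded_iff by force
  \<comment> \<open>The interval \<open>{-M..M}\<close> contains all values of \<open>x + b\<close>,
    so a single Hoelder constant of \<open>h\<close> serves the whole path.\<close>
  define M where "M = B + \<bar>b\<bar>"
  have M: "x t + b \<in> {-M..M}" if "t \<in> {0..T}" for t
    using B[OF that] by (auto simp: M_def)
  have seg: "closed_segment (x s + b) (x t + b) \<subseteq> {-M..M}" if "s \<in> {0..T}" "t \<in> {0..T}" for s t
    using M that by (intro closed_segment_subset) auto
  obtain C where C: "C \<ge> 0" "\<And>u v. u \<in> {-M..M} \<Longrightarrow> v \<in> {-M..M} \<Longrightarrow> \<bar>h v - h u\<bar> \<le> C * \<bar>v - u\<bar> powr \<alpha>"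
    using hoelder_onE[OF h] by metis
  obtain K where K: "K \<ge> 0" "\<And>s t. s \<in> {0..T} \<Longrightarrow> t \<in> {0..T} \<Longrightarrow> \<bar>x t - x s\<bar> \<le> K * \<bar>t - s\<bar> powr \<gamma>"
    using hoelder_onE[OF x] by blast
  \<comment> \<open>Turns powers of increments of \<open>x\<close> into powers of time:
    \<open>e = 1 + \<alpha>\<close> for the controlled remainder, \<open>e = 2 + \<alpha>\<close>
    for the integral.\<close>
  have K': "C * \<bar>x t - x s\<bar> powr e \<le> C * K powr e * (t - s) powr (e * \<gamma>)"
    if "s \<in> {0..T}" "t \<in> {0..T}" "s < t" "e \<ge> 0" for s t e
  proof -
    have "C * \<bar>x t - x s\<bar> powr e \<le> C * (K * \<bar>t - s\<bar> powr \<gamma>) powr e"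
      using C(1) K(2)[of s t] that by (intro mult_left_mono powr_mono2) auto
    then show ?thesis
      using K(1) that by (simp add: powr_mult powr_powr mult_ac)
  qed
  have hz: "hoelder_on (\<alpha> * \<gamma>) {0..T} (\<lambda>t. h (x t + b))"
    using h[of M] x M \<open>\<alpha> > 0\<close> by (intro hoelder_on_compose) auto
  have "bounded (h ` {-M..M})"
  proof (rule boundedI)
    fix w assume "w \<in> h ` {-M..M}"
    then obtain u where u: "w = h u" "u \<in> {-M..M}" by auto
    \<comment> \<open>The existence of \<open>u\<close> forces \<open>M \<ge> 0\<close>, so
      \<open>0\<close> lies in the interval and can serve as base point.\<close>
    have "\<bar>h u - h 0\<bar> \<le> C * \<bar>u - 0\<bar> powr \<alpha>"
      using u by (intro C(2)) auto
    also have "\<dots> \<le> C * M powr \<alpha>"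
      using u C(1) \<open>\<alpha> > 0\<close> by (intro mult_left_mono powr_mono2) auto
    finally show "norm w \<le> \<bar>h 0\<bar> + C * M powr \<alpha>" using u by simp
  qed
  \<comment> \<open>With \<open>g\<close> Lipschitz on the interval, \<open>g\<close> along the path
    keeps the exponent \<open>\<gamma>\<close> of \<open>x\<close>.\<close>
  then have gM: "hoelder_on 1 {-M..M} g" by (rule hoelder_on_of_bounded_derivative[OF g])
  have gz: "hoelder_on \<gamma> {0..T} (\<lambda>t. g (x t + b))"
    using hoelder_on_compose[OF gM x, of b] M by simp
  show "weakly_controlled T \<gamma> ((1 + \<alpha>) * \<gamma>) x (\<lambda>t. g (x t + b)) (\<lambda>t. h (x t + b))"
    unfolding weakly_controlled_def
  proof (intro conjI)
    let ?r = "\<lambda>s t. g (x t + b) - g (x s + b) - h (x s + b) * (x t - x s)"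
    have "\<bar>?r s t\<bar> / \<bar>t - s\<bar> powr ((1 + \<alpha>) * \<gamma>) \<le> C * K powr (1 + \<alpha>)"
      if "0 \<le> s" "s < t" "t \<le> T" for s t
    proof -
      have st: "s \<in> {0..T}" "t \<in> {0..T}" using that by auto
      have "\<bar>g (x t + b) - g (x s + b) - h (x s + b) * ((x t + b) - (x s + b))\<bar>
          \<le> C * \<bar>(x t + b) - (x s + b)\<bar> powr (1 + \<alpha>)"
        by (rule taylor_remainder_hoelder)
           (use seg[OF st] g C M[OF st(1)] \<open>\<alpha> > 0\<close> in \<open>auto simp: subset_iff\<close>)
      then have "\<bar>?r s t\<bar> \<le> C * \<bar>x t - x s\<bar> powr (1 + \<alpha>)" by simp
      also have "\<dots> \<le> C * K powr (1 + \<alpha>) * (t - s) powr ((1 + \<alpha>) * \<gamma>)"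
        using st that \<open>\<alpha> > 0\<close> by (intro K') auto
      finally show ?thesis using that by (simp add: divide_le_eq)
    qed
    then show "\<exists>r. (\<forall>s t. 0 \<le> s \<and> s \<le> t \<and> t \<le> T \<longrightarrow>
          increment (\<lambda>t. g (x t + b)) s t = h (x s + b) * increment x s t + r s t) \<and>
        (\<exists>C. \<forall>s t. 0 \<le> s \<and> s < t \<and> t \<le> T \<longrightarrow> \<bar>r s t\<bar> / \<bar>t - s\<bar> powr ((1 + \<alpha>) * \<gamma>) \<le> C)"
      by (intro exI[of _ ?r]) (auto simp: increment_def)
    show "bounded ((\<lambda>t. h (x t + b)) ` {0..T})"
      using hoelder_on_bounded[OF hz] assms by simp
  qed (use gz hz assms in \<open>auto simp: algebra_simps\<close>)
  show "has_rough_integral x (\<lambda>t. g (x t + b)) (\<lambda>t. h (x t + b)) 0 t (G (x t + b) - G (x 0 + b))"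
    if t: "t \<in> {0..T}"
  proof (rule has_rough_integral_of_remainder[where C = "C * K powr (2 + \<alpha>)" and \<theta> = "(2 + \<alpha>) * \<gamma>"])
    fix u v assume uv: "0 \<le> u" "u < v" "v \<le> t"
    then have st: "u \<in> {0..T}" "v \<in> {0..T}" using t by auto
    have "\<bar>G (x v + b) - G (x u + b) - g (x u + b) * ((x v + b) - (x u + b))
          - h (x u + b) * ((1 / 2) * ((x v + b) - (x u + b))\<^sup>2)\<bar>
        \<le> C * \<bar>(x v + b) - (x u + b)\<bar> powr (2 + \<alpha>)"
      by (rule taylor_remainder2_hoelder)
         (use seg[OF st] G g C M[OF st(1)] \<open>\<alpha> > 0\<close> in \<open>auto simp: subset_iff\<close>)
    also have "\<dots> \<le> C * K powr (2 + \<alpha>) * (v - u) powr ((2 + \<alpha>) * \<gamma>)"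
      using K'[OF st, of "2 + \<alpha>"] uv \<open>\<alpha> > 0\<close> by simp
    finally show "\<bar>G (x v + b) - G (x u + b) - g (x u + b) * increment x u v
          - h (x u + b) * second_level x u v\<bar> \<le> C * K powr (2 + \<alpha>) * (v - u) powr ((2 + \<alpha>) * \<gamma>)"
      by (simp add: increment_def second_level_def)
  qed (use assms C t in auto)
qed

section \<open>Signed powers\<close>

text \<open>The odd power function, with value \<open>0\<close> at the origin for every exponent. Up
  to constants, \<open>\<phi>\<close>, its inverse and the derivative of
  \<open>\<bar>z\<bar> powr b\<close> have this form.\<close>

definition signed_powr :: "real \<Rightarrow> real \<Rightarrow> real" where
  "signed_powr z b = sgn z * \<bar>z\<bar> powr b"

lemma signed_powr_0 [simp]: "signed_powr 0 b = 0"
  by (simp add: signed_powr_def)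

lemma abs_signed_powr [simp]: "\<bar>signed_powr z b\<bar> = \<bar>z\<bar> powr b"
  by (cases "z = 0") (auto simp: signed_powr_def abs_mult)

lemma sgn_signed_powr [simp]: "sgn (signed_powr z b) = sgn z"
  by (cases "z = 0") (auto simp: signed_powr_def sgn_mult)

lemma signed_powr_signed_powr: "signed_powr (signed_powr z b) c = signed_powr z (b * c)"
  by (simp add: signed_powr_def[of "signed_powr z b"] powr_powr) (simp add: signed_powr_def)

lemma signed_powr_1 [simp]: "signed_powr z 1 = z"
  by (simp add: signed_powr_def sgn_mult_abs)

lemma signed_powr_mult: "c \<ge> 0 \<Longrightarrow> signed_powr (c * z) b = c powr b * signed_powr z b"
  by (cases "c = 0") (auto simp: signed_powr_def sgn_mult abs_mult powr_mult)

text \<open>This factorisation and the next exhibit the difference quotients at the origin, for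
  Caratheodory's form of the derivative.\<close>

lemma signed_powr_eq_mult: "signed_powr z b = z * \<bar>z\<bar> powr (b - 1)"
  by (cases "z = 0") (auto simp: signed_powr_def powr_diff sgn_if)

lemma abs_powr_eq_mult: "\<bar>z\<bar> powr b = signed_powr z (b - 1) * z"
  by (cases "z = 0") (auto simp: signed_powr_def powr_diff sgn_if)

text \<open>A ratio \<open>c / u\<close> in the unit interval is at most
  \<open>(c / u) powr b\<close>. Adding this for \<open>c = v\<close> and \<open>c = u - v\<close>,
  whose ratios sum to \<open>1\<close>, gives subadditivity.\<close>

lemma powr_diff_le_diff_powr:
  fixes u v b :: real
  assumes "0 \<le> v" "v \<le> u" "b \<le> 1"
  shows "u powr b - v powr b \<le> (u - v) powr b"
proof (cases "u > 0")
  case True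
  have le: "c / u \<le> (c / u) powr b" if "0 \<le> c" "c \<le> u" for c
    using powr_mono'[of b 1 "c / u"] that assms True by simp
  have "1 = v / u + (u - v) / u" using True by (simp add: field_simps)
  also have "\<dots> \<le> (v / u) powr b + ((u - v) / u) powr b"
    using assms by (intro add_mono le) auto
  also have "\<dots> = (v powr b + (u - v) powr b) / u powr b"
    using assms True by (simp add: powr_divide add_divide_distrib)
  finally show ?thesis using True by (simp add: le_divide_eq)
next
  case False
  with assms have "u = 0" "v = 0" by auto
  then show ?thesis by simp
qed

text \<open>For arguments of equal sign this follows from subadditivity. For opposite signs
  \<open>\<bar>t\<bar>\<close> and \<open>\<bar>s\<bar>\<close> are both at most
  \<open>\<bar>t - s\<bar>\<close>, and the two terms add up to the constant
  \<open>2\<close>.\<close>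

lemma abs_diff_signed_powr_le:
  assumes "0 < b" "b \<le> 1"
  shows "\<bar>signed_powr t b - signed_powr s b\<bar> \<le> 2 * \<bar>t - s\<bar> powr b"
proof -
  have pos: "\<bar>u powr b - v powr b\<bar> \<le> \<bar>u - v\<bar> powr b" if "u \<ge> 0" "v \<ge> 0" for u v :: real
    using powr_diff_le_diff_powr[of v u b] powr_diff_le_diff_powr[of u v b]
      powr_mono2[of b u v] powr_mono2[of b v u] that assms by (cases "v \<le> u") auto
  have nonneg: "\<bar>t - s\<bar> powr b \<ge> 0" by simp
  consider "t \<ge> 0" "s \<ge> 0" | "t \<le> 0" "s \<le> 0" | "s < 0 \<and> 0 < t \<or> t < 0 \<and> 0 < s" by linarith
  then show ?thesis
  proof cases
    case 1
    then show ?thesis using pos[of t s] nonneg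
      by (auto simp: signed_powr_def sgn_if)
  next
    case 2
    then show ?thesis using pos[of "-t" "-s"] nonneg
      by (auto simp: signed_powr_def sgn_if abs_minus_commute)
  next
    case 3
    then have "\<bar>t\<bar> powr b \<le> \<bar>t - s\<bar> powr b" "\<bar>s\<bar> powr b \<le> \<bar>t - s\<bar> powr b"
      using assms by (auto intro!: powr_mono2)
    moreover have "\<bar>signed_powr t b - signed_powr s b\<bar> \<le> \<bar>t\<bar> powr b + \<bar>s\<bar> powr b"
      using abs_triangle_ineq4[of "signed_powr t b" "signed_powr s b"] by simp
    ultimately show ?thesis by linarith
  qed
qed

section \<open>Calculus of power functions at and away from the origin\<close>

lemma isCont_abs_powr:
  assumes "b > 0"
  shows "isCont (\<lambda>z::real. \<bar>z\<bar> powr b) z"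
  unfolding isCont_def using assms by (intro tendsto_powr2 tendsto_intros) auto

lemma isCont_signed_powr_0:
  assumes "b > 0"
  shows "isCont (\<lambda>z. signed_powr z b) 0"
proof -
  have "((\<lambda>z. signed_powr z b) \<longlongrightarrow> 0) (at 0)"
  proof (rule Lim_null_comparison)
    show "\<forall>\<^sub>F u in at 0. norm (signed_powr u b) \<le> \<bar>u\<bar> powr b" by simp
    show "((\<lambda>u::real. \<bar>u\<bar> powr b) \<longlongrightarrow> 0) (at 0)"
      using isCont_abs_powr[OF assms, of 0] by (simp add: isCont_def)
  qed
  then show ?thesis by (simp add: isCont_def)
qed

text \<open>Away from the origin this is the power rule on each half-line. At the origin the slope
  \<open>signed_powr u (b - 1)\<close> is continuous because \<open>b > 1\<close>.\<close>

lemma DERIV_abs_powr: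
  assumes "z \<noteq> 0 \<or> b > 1"
  shows "((\<lambda>z. \<bar>z\<bar> powr b) has_real_derivative b * signed_powr z (b - 1)) (at z)"
proof -
  consider "z > 0" | "z < 0" | "z = 0" "b > 1" using assms by linarith
  then show ?thesis
  proof cases
    case 1
    then have "((\<lambda>z. z powr b) has_real_derivative b * signed_powr z (b - 1)) (at z)"
      using has_real_derivative_powr[of z b] by (simp add: signed_powr_def)
    then show ?thesis
      by (rule has_field_derivative_transform_within_open[where S = "{0<..}"]) (use 1 in auto)
  next
    case 2
    have "((\<lambda>z. (- z) powr b) has_real_derivative b * signed_powr z (b - 1)) (at z)"
      using 2 by (auto intro!: derivative_eq_intros simp: signed_powr_def)
    then show ?thesis
      by (rule has_field_derivative_transform_within_open[where S = "{..<0}"]) (use 2 in auto)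
  next
    case 3
    then show ?thesis
      using isCont_signed_powr_0[of "b - 1"]
      by (auto simp: CARAT_DERIV abs_powr_eq_mult[of _ b] intro!: exI[of _ "\<lambda>u. signed_powr u (b - 1)"])
  qed
qed

text \<open>At the origin the slope \<open>\<bar>u\<bar> powr (b - 1)\<close> is continuous;
  elsewhere the product rule gives the coefficient \<open>1 + (b - 1)\<close>.\<close>

lemma DERIV_signed_powr:
  assumes "z \<noteq> 0 \<or> b > 1"
  shows "((\<lambda>z. signed_powr z b) has_real_derivative b * \<bar>z\<bar> powr (b - 1)) (at z)"
proof (cases "z = 0")
  case True
  then show ?thesis
    using assms isCont_abs_powr[of "b - 1" 0]
    by (auto simp: CARAT_DERIV signed_powr_eq_mult[of _ b] intro!: exI[of _ "\<lambda>u. \<bar>u\<bar> powr (b - 1)"])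
next
  case False
  have "((\<lambda>z. z * \<bar>z\<bar> powr (b - 1)) has_real_derivative
      \<bar>z\<bar> powr (b - 1) + ((b - 1) * signed_powr z (b - 1 - 1)) * z) (at z)"
    using DERIV_mult[OF DERIV_ident DERIV_abs_powr, of z "b - 1"] False by simp
  then show ?thesis
    by (simp add: signed_powr_eq_mult[of _ b, abs_def] abs_powr_eq_mult[of z "b - 1"] algebra_simps)
qed

lemma isCont_signed_powr:
  assumes "b > 0"
  shows "isCont (\<lambda>z. signed_powr z b) z"
  using isCont_signed_powr_0[OF assms] DERIV_isCont[OF DERIV_signed_powr] by (cases "z = 0") auto

text \<open>For \<open>b > 1\<close> the derivative is bounded on the interval; for
  \<open>b \<le> 1\<close> the estimate is global, with constant \<open>2\<close>.\<close>

lemma hoelder_on_signed_powr: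
  assumes "b > 0"
  shows "hoelder_on (min 1 b) {-M..M} (\<lambda>z. signed_powr z b)"
proof (cases "b > 1")
  case True
  have "bounded ((\<lambda>z. b * \<bar>z\<bar> powr (b - 1)) ` {-M..M})"
  proof (rule boundedI)
    fix w assume "w \<in> (\<lambda>z. b * \<bar>z\<bar> powr (b - 1)) ` {-M..M}"
    then show "norm w \<le> b * M powr (b - 1)"
      using True by (auto simp: abs_mult intro!: powr_mono2)
  qed
  then have "hoelder_on 1 {-M..M} (\<lambda>z. signed_powr z b)"
    using True by (intro hoelder_on_of_bounded_derivative[OF DERIV_signed_powr]) auto
  then show ?thesis using True by simp
next
  case False
  then show ?thesis
    using abs_diff_signed_powr_le[OF assms] by (auto simp: hoelder_on_def)
qed

text \<open>The integrand is unbounded near the origin when \<open>\<kappa> > 0\<close>, but the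
  primitive is continuous there as \<open>1 - \<kappa> > 0\<close>. The fundamental theorem for
  nonnegative integrands asks only for one-sided limits at the endpoints.\<close>

lemma LBINT_inverse_abs_powr:
  assumes "0 \<le> \<kappa>" "\<kappa> < 1"
  shows "(LBINT s=0..\<xi>. 1 / \<bar>s\<bar> powr \<kappa>) = signed_powr \<xi> (1 - \<kappa>) / (1 - \<kappa>)"
proof -
  let ?F = "\<lambda>z. signed_powr z (1 - \<kappa>) / (1 - \<kappa>)"
  have F: "(?F has_real_derivative 1 / \<bar>z\<bar> powr \<kappa>) (at z)" if "z \<noteq> 0" for z
    using that assms
    by (auto intro!: derivative_eq_intros DERIV_signed_powr simp: powr_minus_divide)
  have cont: "isCont ?F z" for z
    using assms by (intro continuous_intros isCont_signed_powr) auto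
  have lims: "((?F \<circ> real_of_ereal) \<longlongrightarrow> ?F z) (at_right (ereal z))"
    "((?F \<circ> real_of_ereal) \<longlongrightarrow> ?F z) (at_left (ereal z))" for z
    using cont[of z] unfolding ereal_tendsto_simps
    by (auto simp: isCont_def intro: filterlim_at_within_not_equal tendsto_within_subset)
  have "(LBINT s=ereal a..ereal b. 1 / \<bar>s\<bar> powr \<kappa>) = ?F b - ?F a"
    if "a < b" "0 \<notin> {a<..<b}" for a b
    using that
    by (intro interval_integral_FTC_nonneg(2)[where F = ?F] lims F)
       (auto intro!: continuous_intros)
  \<comment> \<open>A negative \<open>\<xi>\<close> is handled by integrating from
    \<open>\<xi>\<close> to \<open>0\<close> and reversing the endpoints.\<close>
  from this[of 0 \<xi>] this[of \<xi> 0] show ?thesis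
    by (cases \<xi> "0 :: real" rule: linorder_cases)
       (auto simp: interval_integral_endpoints_reverse[of "ereal 0"] zero_ereal_def)
qed

section \<open>The explicit solution \<open>G (x t + \<phi> a)\<close> of the rough equation\<close>

theorem theorem1p1:
  fixes T \<gamma> \<kappa> a :: real and x \<sigma> \<phi> y :: "real \<Rightarrow> real"
  assumes "T > 0"
    and "1 / 3 < \<gamma>" and "\<gamma> \<le> 1 / 2"
    and "0 < \<kappa>" and "\<kappa> < 1" and "\<kappa> + \<gamma> > 1"
    and "hoelder_on \<gamma> {0..T} x" and "x 0 = 0"
    and "\<sigma> = (\<lambda>\<xi>. \<bar>\<xi>\<bar> powr \<kappa>)"
    and "\<phi> = (\<lambda>\<xi>. LBINT s=0..\<xi>. 1 / \<sigma> s)"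
    and "y = (\<lambda>t. inv \<phi> (x t + \<phi> a))"
  shows "solves_rough_equation T \<gamma> x \<sigma> a y"
proof -
  define p where "p = 1 / (1 - \<kappa>)"
  define \<alpha> where "\<alpha> = min 1 (p - 2)"
  \<comment> \<open>The factor \<open>1 - \<kappa>\<close> inside the powers undoes the division in
    \<open>\<phi>\<close>. By \<open>p * (1 - \<kappa>) = 1\<close> and
    \<open>(1 - \<kappa>) * (p - 1) = \<kappa>\<close>, differentiation produces exactly the
    coefficients \<open>1\<close> in \<open>g\<close> and \<open>\<kappa>\<close> in
    \<open>h\<close>.\<close>
  define G where "G = (\<lambda>z. signed_powr ((1 - \<kappa>) * z) p)"
  define g where "g = (\<lambda>z. \<bar>(1 - \<kappa>) * z\<bar> powr (p - 1))"
  define h where "h = (\<lambda>z. \<kappa> * signed_powr ((1 - \<kappa>) * z) (p - 2))"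
  have p: "(1 - \<kappa>) * p = 1" "p * (1 - \<kappa>) = 1" using assms by (auto simp: p_def)
  have "p * \<gamma> > p * (1 - \<kappa>)"
    using assms by (intro mult_strict_left_mono) (auto simp: p_def)
  then have p\<gamma>: "p * \<gamma> > 1" using p by simp
  have "p > 2"
  proof (rule ccontr)
    assume "\<not> p > 2"
    \<comment> \<open>Here \<open>\<gamma> \<le> 1 / 2\<close> enters: \<open>p \<le> 2\<close>
      would give \<open>p * \<gamma> \<le> 1\<close>.\<close>
    then have "p * \<gamma> \<le> 2 * (1 / 2)" using assms by (intro mult_mono) auto
    with p\<gamma> show False by simp
  qed
  then have \<alpha>: "\<alpha> > 0" by (simp add: \<alpha>_def)
  have order: "(2 + \<alpha>) * \<gamma> > 1"
    \<comment> \<open>For \<open>\<alpha> = 1\<close> the claim is \<open>3 * \<gamma> > 1\<close>;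
      for \<open>\<alpha> = p - 2\<close> it is \<open>p * \<gamma> > 1\<close>.\<close>
    using assms(2) p\<gamma> by (auto simp: \<alpha>_def min_def)
  have \<phi>: "\<phi> = (\<lambda>\<xi>. signed_powr \<xi> (1 - \<kappa>) / (1 - \<kappa>))"
    using assms LBINT_inverse_abs_powr by simp
  have G\<phi>: "G (\<phi> \<xi>) = \<xi>" for \<xi>
    using assms(5) p by (simp add: G_def \<phi> signed_powr_signed_powr)
  have \<phi>G: "\<phi> (G z) = z" for z
    using assms(5) p by (simp add: G_def \<phi> signed_powr_signed_powr)
  have y: "y = (\<lambda>t. G (x t + \<phi> a))"
    using inv_equality[of G \<phi>] G\<phi> \<phi>G assms by simp
  \<comment> \<open>In order: the coefficient in the derivative of \<open>g\<close>, the exponent of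
    \<open>\<sigma>\<close> along \<open>G\<close>, and the exponent of
    \<open>\<sigma>'\<sigma>\<close> along \<open>G\<close>.\<close>
  have \<kappa>: "\<kappa> = (1 - \<kappa>) * (p - 1)" "p * \<kappa> = p - 1" "p * (\<kappa> - 1) + (p - 1) = p - 2"
    using p by (auto simp: algebra_simps)
  have \<sigma>G: "\<sigma> (G z) = g z" for z
    using \<kappa> assms by (simp add: G_def g_def powr_powr)
  have hG: "deriv_times_self \<sigma> (G z) = h z" for z
  proof (cases "z = 0")
    \<comment> \<open>The value \<open>0\<close> prescribed for \<open>\<sigma>'\<sigma>\<close> at
      the origin agrees with \<open>h 0\<close>.\<close>
    case True
    then show ?thesis by (simp add: G_def h_def deriv_times_self_def)
  next
    case False
    let ?w = "(1 - \<kappa>) * z"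
    have nz: "?w \<noteq> 0" using False assms by simp
    then have Gnz: "G z \<noteq> 0" by (simp add: G_def signed_powr_def sgn_if)
    have "deriv \<sigma> (G z) = \<kappa> * signed_powr (G z) (\<kappa> - 1)"
      using Gnz assms by (auto intro!: DERIV_imp_deriv DERIV_abs_powr)
    also have "\<dots> = \<kappa> * signed_powr ?w (p * (\<kappa> - 1))"
      by (simp add: G_def signed_powr_signed_powr)
    finally have "deriv_times_self \<sigma> (G z) = \<kappa> * signed_powr ?w (p * (\<kappa> - 1)) * \<bar>?w\<bar> powr (p - 1)"
      using Gnz by (simp add: deriv_times_self_def \<sigma>G g_def)
    also have "\<dots> = \<kappa> * (sgn ?w * \<bar>?w\<bar> powr (p * (\<kappa> - 1) + (p - 1)))"
      by (simp only: signed_powr_def powr_add mult.assoc)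
    also have "\<dots> = h z"
      by (simp only: \<kappa>(3) h_def signed_powr_def)
    finally show ?thesis .
  qed
  have DG: "(G has_real_derivative g z) (at z)" for z
  proof -
    have "(G has_real_derivative (p * \<bar>(1 - \<kappa>) * z\<bar> powr (p - 1)) * (1 - \<kappa>)) (at z)"
      unfolding G_def
      by (rule DERIV_chain2[OF DERIV_signed_powr DERIV_cmult_Id]) (use \<open>p > 2\<close> in simp)
    moreover have "(p * \<bar>(1 - \<kappa>) * z\<bar> powr (p - 1)) * (1 - \<kappa>) = (p * (1 - \<kappa>)) * g z"
      by (simp only: g_def mult_ac)
    ultimately show ?thesis using p by simp
  qed
  have Dg: "(g has_real_derivative h z) (at z)" for z
  proof -
    have "(g has_real_derivative ((p - 1) * signed_powr ((1 - \<kappa>) * z) (p - 1 - 1)) * (1 - \<kappa>)) (at z)"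
      unfolding g_def
      by (rule DERIV_chain2[OF DERIV_abs_powr DERIV_cmult_Id]) (use \<open>p > 2\<close> in simp)
    moreover have "((p - 1) * signed_powr ((1 - \<kappa>) * z) (p - 1 - 1)) * (1 - \<kappa>)
        = ((1 - \<kappa>) * (p - 1)) * signed_powr ((1 - \<kappa>) * z) (p - 2)"
      by (simp add: mult_ac)
    ultimately show ?thesis by (simp only: h_def \<kappa>(1)[symmetric])
  qed
  \<comment> \<open>The constants \<open>\<kappa>\<close> and
    \<open>(1 - \<kappa>) powr (p - 2)\<close> are pulled out, leaving
    \<open>signed_powr z (p - 2)\<close>.\<close>
  have "hoelder_on \<alpha> {-M..M} h" for M
    using \<open>p > 2\<close> assms(5)
    by (auto simp: h_def \<alpha>_def signed_powr_mult mult.assoc[symmetric]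
        intro!: hoelder_on_cmult hoelder_on_signed_powr)
  note chain = rough_chain_rule[OF DG Dg this assms(7) \<alpha> _ order, where b = "\<phi> a"]
  show ?thesis
    unfolding solves_rough_equation_def y \<sigma>G hG
  proof (intro conjI exI ballI)
    show "(1 + \<alpha>) * \<gamma> + \<gamma> > 1" using order by (simp add: algebra_simps)
    show "weakly_controlled T \<gamma> ((1 + \<alpha>) * \<gamma>) x (\<lambda>t. g (x t + \<phi> a)) (\<lambda>t. h (x t + \<phi> a))"
      using assms(2) by (intro chain(1)) simp
  next
    fix t assume "t \<in> {0..T}"
    then show "has_rough_integral x (\<lambda>t. g (x t + \<phi> a)) (\<lambda>t. h (x t + \<phi> a)) 0 t
        (G (x t + \<phi> a) - G (x 0 + \<phi> a))"
      using assms(2) by (intro chain(2)) simp_all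
    \<comment> \<open>As \<open>x 0 = 0\<close> and \<open>G (\<phi> a) = a\<close>, the subtracted
      starting value is the initial condition.\<close>
    show "G (x t + \<phi> a) = a + (G (x t + \<phi> a) - G (x 0 + \<phi> a))"
      using G\<phi> assms(8) by simp
  qed
qed

end
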